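(* Let $p_1,p_2,\dots\ge0$ with $\sum_{m=1}^\infty p_m=1$, let $\eta_1,\eta_2,\dots$ be independent identically distributed random variables taking each value $m\in\mathbb N$ with probability $p_m$, and let $\eta=\bar O^2(\eta_1,\eta_2,\dots,\eta_k,\dots)$. Then the distribution of $\eta$ is: (1) purely atomic with a unique atom, if and only if $p_i=1$ for some $i\in\mathbb N$; (2) singularly continuous in all other cases (i.e. it has no atoms and is concentrated on a Borel set of Lebesgue measure zero).
   Context: $\mathbb N=\{1,2,3,\dots\}$. For a sequence $(d_k)_{k\ge1}$ of positive integers put $q_1=d_1$ and $q_{k+1}=q_k(q_k+1)-1+d_{k+1}$ for $k\ge1$, and define $\bar O^2(d_1,d_2,\dots)=\sum_{n\ge1}\frac{(-1)^{n-1}}{q_n}$. (This gives a bijection from $\mathbb N^{\mathbb N}$ onto the irrationals of $(0,1)$, called the $\bar O^2$-expansion, or second Ostrogradsky expansion with independent increments.) *)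

theory Defs
  imports "HOL-Probability.Probability"
begin

(* Sequences are indexed from 0: d k and ostr_q d k stand for d_{k+1} and q_{k+1}.
   For positive increments every q is at least 1, so the subtraction on nat does not truncate. *)
fun ostr_q :: "(nat \<Rightarrow> nat) \<Rightarrow> nat \<Rightarrow> nat" where
  "ostr_q d 0 = d 0"
| "ostr_q d (Suc k) = ostr_q d k * (ostr_q d k + 1) - 1 + d (Suc k)"

definition ostr_bar2 :: "(nat \<Rightarrow> nat) \<Rightarrow> real" where
  "ostr_bar2 d = (\<Sum>n. (-1) ^ n / real (ostr_q d n))"

text \<open>The next result ensures that the push-forward \<^term>\<open>distr M borel\<close> along
  \<^const>\<open>ostr_bar2\<close> is the actual distribution rather than a junk value.\<close>

lemma borel_measurable_ostr_bar2:
  assumes "\<And>k. \<eta> k \<in> measurable M (count_space UNIV)"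
  shows "(\<lambda>\<omega>. ostr_bar2 (\<lambda>k. \<eta> k \<omega>)) \<in> borel_measurable M"
proof -
  note assms [measurable]
  have [measurable]: "(\<lambda>\<omega>. ostr_q (\<lambda>k. \<eta> k \<omega>) n) \<in> measurable M (count_space UNIV)" for n
    by (induction n) simp_all
  show ?thesis
    unfolding ostr_bar2_def by measurable
qed

definition is_atom :: "real measure \<Rightarrow> real \<Rightarrow> bool" where
  "is_atom \<mu> x \<longleftrightarrow> measure \<mu> {x} > 0"

definition purely_atomic :: "real measure \<Rightarrow> bool" where
  "purely_atomic \<mu> \<longleftrightarrow> (AE x in \<mu>. is_atom \<mu> x)"

definition singularly_continuous :: "real measure \<Rightarrow> bool" where
  "singularly_continuous \<mu> \<longleftrightarrow>
     (\<forall>x. \<not> is_atom \<mu> x) \<and>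
     (\<exists>B \<in> sets borel. emeasure lborel B = 0 \<and> emeasure \<mu> (space \<mu> - B) = 0)"

end

theory Submission
  imports Defs
begin

text \<open>
  Singularity comes from the enormous speed with which the denominators grow. If the denominators
  so far end in \<open>q\<close>, the numbers whose expansion begins with them span an interval of length
  \<open>1 / (q * (q + 1))\<close>, and those whose next increment is a prescribed \<open>i\<close> span a subinterval of
  length at most \<open>1 / (Q * (Q + 1))\<close> with \<open>Q = q * (q + 1)\<close>. The ratio is less than \<open>1 / Q\<close>, which
  decays at least exponentially in the position, whatever \<open>i\<close> is. By the Borel--Cantelli lemma,
  Lebesgue-almost every number has the increment \<open>i\<close> only finitely often
  (\<open>emeasure_cover\<close>, \<open>limsup_cover_null\<close>). On the other hand, some \<open>i\<close> has \<open>p i > 0\<close>, and independent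
  increments take this value infinitely often almost surely. So the distribution is carried by
  the Lebesgue null set of numbers with infinitely many increments \<open>i\<close>. This holds for every
  choice of \<open>p\<close>; the two cases of the theorem differ only in their atoms.

  If \<open>p i = 1\<close>, the random sequence is almost surely constant and the distribution is a point mass.
  Otherwise all \<open>p m\<close> are bounded by one constant \<open>c < 1\<close>. The expansion is injective
  (\<open>ostr_from_inj\<close>), so a point is hit by at most one sequence of positive increments, and the
  probability that the first \<open>n\<close> increments follow that sequence is at most \<open>c ^ n\<close>. Hence there are
  no atoms. Both probabilistic arguments rest on \<open>prob_tail_constraint_eq_0\<close>.
\<close>

section \<open>The expansion as a recursion on the increments\<close>

text \<open>An expansion continued from a context: with \<open>b = q * (q + 1) - 1\<close> this is, up to sign, the
  remainder of an expansion after the denominator \<open>q\<close>, and \<open>b = 0\<close> gives the whole expansion.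
  Carrying the offset separately keeps the increments themselves unchanged under a shift, so that
  statements about the \<open>n\<close>-th increment can be proved by induction on \<open>n\<close>.\<close>
definition ostr_from :: "nat \<Rightarrow> (nat \<Rightarrow> nat) \<Rightarrow> real" where
  "ostr_from b d = ostr_bar2 (d(0 := b + d 0))"

lemma ostr_from_0 [simp]: "ostr_from 0 d = ostr_bar2 d"
  by (simp add: ostr_from_def)

lemma ostr_q_Suc_gt:
  assumes "ostr_q d n \<ge> 1" "d (Suc n) \<ge> 1"
  shows "ostr_q d (Suc n) > ostr_q d n"
proof -
  have "1 * (ostr_q d n + 1) \<le> ostr_q d n * (ostr_q d n + 1)"
    using assms(1) by (intro mult_right_mono) auto
  then have "ostr_q d n < ostr_q d n * (ostr_q d n + 1) - 1 + d (Suc n)"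
    using assms by arith
  then show ?thesis by simp
qed

lemma ostr_q_ge:
  assumes "\<And>k. d k \<ge> 1"
  shows "ostr_q d n \<ge> Suc n"
proof (induction n)
  case 0
  then show ?case using assms[of 0] by simp
next
  case (Suc n)
  with ostr_q_Suc_gt[of d n] assms show ?case by fastforce
qed

lemma ostr_terms_tendsto_0:
  assumes "\<And>k. d k \<ge> 1"
  shows "(\<lambda>n. 1 / real (ostr_q d n)) \<longlonglongrightarrow> 0"
proof (rule tendsto_sandwich[of "\<lambda>_. 0" _ _ "\<lambda>n. 1 / real (Suc n)"])
  show "(\<lambda>n. 1 / real (Suc n)) \<longlonglongrightarrow> 0"
    using LIMSEQ_Suc[OF lim_1_over_n[where 'a=real]] by simp
  have "1 / real (ostr_q d n) \<le> 1 / real (Suc n)" for n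
  proof (rule divide_left_mono)
    show "real (Suc n) \<le> real (ostr_q d n)" using ostr_q_ge[of d n, OF assms] by linarith
    then show "0 < real (ostr_q d n) * real (Suc n)" by simp
  qed simp
  then show "\<forall>\<^sub>F n in sequentially. 1 / real (ostr_q d n) \<le> 1 / real (Suc n)" by simp
qed auto

lemma ostr_terms_decreasing:
  assumes "\<And>k. d k \<ge> 1"
  shows "1 / real (ostr_q d (Suc n)) \<le> 1 / real (ostr_q d n)"
proof (rule divide_left_mono)
  have "ostr_q d n \<ge> 1" using ostr_q_ge[of d n, OF assms] by linarith
  then show "real (ostr_q d n) \<le> real (ostr_q d (Suc n))"
    using ostr_q_Suc_gt[of d n] assms by (simp del: ostr_q.simps)
  with \<open>ostr_q d n \<ge> 1\<close> show "0 < real (ostr_q d (Suc n)) * real (ostr_q d n)"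
    by (simp del: ostr_q.simps)
qed simp

lemma ostr_bar2_summable_bounds:
  assumes "\<And>k. d k \<ge> 1"
  shows "summable (\<lambda>n. (-1) ^ n / real (ostr_q d n))"
    and "0 \<le> ostr_bar2 d" and "ostr_bar2 d \<le> 1 / d 0"
proof -
  note L = summable_Leibniz'[of "\<lambda>n. 1 / real (ostr_q d n)",
      OF ostr_terms_tendsto_0[OF assms] _ ostr_terms_decreasing[OF assms]]
  show "summable (\<lambda>n. (-1) ^ n / real (ostr_q d n))" using L(1) by simp
  show "0 \<le> ostr_bar2 d" using L(2)[of 0] by (simp add: ostr_bar2_def)
  show "ostr_bar2 d \<le> 1 / d 0" using L(4)[of 0] by (simp add: ostr_bar2_def)
qed

lemma ostr_q_shift:
  fixes d :: "nat \<Rightarrow> nat"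
  shows "ostr_q d (Suc n) = ostr_q ((\<lambda>k. d (Suc k))(0 := (d 0 * (d 0 + 1) - 1) + d 1)) n"
  by (induction n) auto

text \<open>The remainder after the first term is, with reversed sign, again an expansion, with
  the same increments shifted by one. This is the self-similarity behind every induction below.\<close>
lemma ostr_from_step:
  fixes d :: "nat \<Rightarrow> nat" and b :: nat
  assumes "\<And>k. d k \<ge> 1"
  defines "q \<equiv> b + d 0"
  shows "ostr_from b d = 1 / q - ostr_from (q * (q + 1) - 1) (\<lambda>k. d (Suc k))"
proof -
  let ?e = "d(0 := q)"
  let ?t = "(\<lambda>k. d (Suc k))(0 := (q * (q + 1) - 1) + d 1)"
  have pos: "?e k \<ge> 1" for k using assms(1)[of k] assms(1)[of 0] by (auto simp: q_def)
  have q: "ostr_q ?e (Suc n) = ostr_q ?t n" for n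
    using ostr_q_shift[of ?e n] by (simp del: ostr_q.simps cong: if_cong)
  have "ostr_bar2 ?e = 1 / q + (\<Sum>n. (-1) ^ Suc n / real (ostr_q ?e (Suc n)))"
    using suminf_split_head[OF ostr_bar2_summable_bounds(1)[of ?e, OF pos]]
    by (simp add: ostr_bar2_def del: ostr_q.simps(2))
  also have "\<dots> = 1 / q - (\<Sum>n. (-1) ^ n / real (ostr_q ?t n))"
    unfolding q using suminf_minus[OF ostr_bar2_summable_bounds(1)[of ?t]] assms(1)
    by (simp add: trans_le_add2)
  finally show ?thesis by (simp add: ostr_from_def ostr_bar2_def q_def)
qed

text \<open>The bounds are strict because the expansion is infinite; strictness is what makes the first
  denominator readable from the value.\<close>
lemma ostr_from_bounds:
  assumes "\<And>k. d k \<ge> 1"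
  shows "1 / (real (b + d 0) + 1) < ostr_from b d" and "ostr_from b d < 1 / real (b + d 0)"
proof -
  have weak: "0 \<le> ostr_from b d \<and> ostr_from b d \<le> 1 / real (b + d 0)"
    if "\<And>k. d k \<ge> 1" for b d
  proof -
    have "(d(0 := b + d 0)) k \<ge> 1" for k using that[of k] by auto
    from ostr_bar2_summable_bounds(2,3)[of "d(0 := b + d 0)", OF this] show ?thesis
      by (simp add: ostr_from_def)
  qed
  have id: "1 / real q - 1 / real (q * (q + 1)) = 1 / (real q + 1)" if "q \<ge> 1" for q :: nat
  proof -
    have "real q > 0" using that by simp
    then have "1 / real q - 1 / (real q * (real q + 1)) = 1 / (real q + 1)"
      by (simp add: divide_simps)
    then show ?thesis by (simp add: algebra_simps)
  qed
  have shrink: "1 / real (q * (q + 1) - 1 + d (Suc 0)) \<le> 1 / real (q * (q + 1))"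
    if "\<And>k. d k \<ge> 1" "q \<ge> 1" for d :: "nat \<Rightarrow> nat" and q
  proof (rule divide_left_mono)
    have "q * (q + 1) \<le> q * (q + 1) - 1 + d (Suc 0)" using that(1)[of "Suc 0"] by linarith
    then show "real (q * (q + 1)) \<le> real (q * (q + 1) - 1 + d (Suc 0))"
      by (rule of_nat_mono)
    with \<open>q \<ge> 1\<close> show "0 < real (q * (q + 1) - 1 + d (Suc 0)) * real (q * (q + 1))"
      by (intro mult_pos_pos) (auto intro: less_le_trans simp del: of_nat_mult)
  qed simp
  \<comment> \<open>The recursion turns the weak upper bound on the remainder into positivity, positivity
    into the strict upper bound, and that into the strict lower bound.\<close>
  have positive: "0 < ostr_from b d" if d: "\<And>k. d k \<ge> 1" for b d
  proof -
    have q: "b + d 0 \<ge> 1" using d[of 0] by simp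
    have "0 < 1 / (real (b + d 0) + 1)" by (simp add: add_pos_nonneg)
    also have "\<dots> \<le> ostr_from b d"
      unfolding ostr_from_step[of d b, OF d] id[OF q, symmetric]
      using weak[of "\<lambda>k. d (Suc k)" "(b + d 0) * (b + d 0 + 1) - 1", OF d] shrink[of d, OF d q]
      by linarith
    finally show ?thesis .
  qed
  have upper: "ostr_from b d < 1 / real (b + d 0)" if d: "\<And>k. d k \<ge> 1" for b d
    unfolding ostr_from_step[of d b, OF d] using positive[of "\<lambda>k. d (Suc k)", OF d] by simp
  show "ostr_from b d < 1 / real (b + d 0)" by (rule upper[OF assms])
  have q: "b + d 0 \<ge> 1" using assms[of 0] by simp
  show "1 / (real (b + d 0) + 1) < ostr_from b d"
    unfolding ostr_from_step[of d b, OF assms] id[OF q, symmetric]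
    using upper[of "\<lambda>k. d (Suc k)" "(b + d 0) * (b + d 0 + 1) - 1", OF assms]
      shrink[of d, OF assms q] by linarith
qed

lemma first_denominator_unique:
  fixes q r :: nat and x :: real
  assumes "1 / (real q + 1) < x" "x < 1 / real q" "1 / (real r + 1) < x" "x < 1 / real r"
    and "q \<ge> 1" "r \<ge> 1"
  shows "q = r"
proof -
  have "\<not> q < r" if "1 / (real q + 1) < x" "x < 1 / real r" "q \<ge> 1" for q r :: nat
  proof
    assume "q < r"
    then have "1 / real r \<le> 1 / (real q + 1)" using \<open>q \<ge> 1\<close> by (intro divide_left_mono) auto
    with that show False by linarith
  qed
  from this[of q r] this[of r q] assms show ?thesis by auto
qed

text \<open>The open intervals \<open>(1 / (q + 1), 1 / q)\<close> are disjoint, so the value determines the first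
  denominator and with it the remainder; the recursion then yields every further increment.\<close>
lemma ostr_from_inj:
  assumes "\<And>k. d k \<ge> 1" "\<And>k. e k \<ge> 1" "ostr_from b d = ostr_from b e"
  shows "d k = e k"
  using assms
proof (induction k arbitrary: b d e)
  case (0 b d e)
  then have "b + d 0 = b + e 0"
    using ostr_from_bounds[of d b] ostr_from_bounds[of e b]
    by (intro first_denominator_unique[of _ "ostr_from b d"]) (auto simp: trans_le_add2)
  then show ?case by simp
next
  case (Suc k b d e)
  have "b + d 0 = b + e 0"
    using ostr_from_bounds[of d b] ostr_from_bounds[of e b] Suc.prems
    by (intro first_denominator_unique[of _ "ostr_from b d"]) (auto simp: trans_le_add2)
  then have "ostr_from ((b + d 0) * (b + d 0 + 1) - 1) (\<lambda>k. d (Suc k)) =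
      ostr_from ((b + d 0) * (b + d 0 + 1) - 1) (\<lambda>k. e (Suc k))"
    using ostr_from_step[of d b] ostr_from_step[of e b] Suc.prems by simp
  from Suc.IH[OF _ _ this] Suc.prems show ?case by simp
qed

section \<open>Lebesgue measure of the set where an increment is prescribed\<close>

text \<open>A Borel superset of the numbers \<open>ostr_from b d\<close> with \<open>d n = i\<close>. The union runs over the possible
  first denominators \<open>q = Suc (b + j)\<close>, and \<open>x \<mapsto> 1 / q - x\<close> takes a number to its remainder.
  Only this inclusion is needed to bound measures, so the increments never have to be treated as
  measurable functions of the number.\<close>
primrec cover :: "nat \<Rightarrow> nat \<Rightarrow> nat \<Rightarrow> real set" where
  "cover i 0 b = {1 / (real (b + i) + 1) .. 1 / real (b + i)}"
| "cover i (Suc n) b =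
     (\<Union>j. (\<lambda>x. 1 / real (Suc (b + j)) - x) -` cover i n (Suc (b + j) * (Suc (b + j) + 1) - 1))"

lemma cover_borel [measurable]: "cover i n b \<in> sets borel"
proof (induction n arbitrary: b)
  case (Suc n)
  have "(\<lambda>x. 1 / real (Suc (b + j)) - x) -` cover i n c \<inter> space borel \<in> sets borel" for j c
    by (rule measurable_sets[OF _ Suc.IH]) measurable
  then show ?case by (simp del: of_nat_Suc)
qed simp

lemma ostr_from_in_cover:
  assumes "\<And>k. d k \<ge> 1" "d n = i"
  shows "ostr_from b d \<in> cover i n b"
  using assms
proof (induction n arbitrary: b d)
  case 0
  with ostr_from_bounds[of d b] show ?case by force
next
  case (Suc n)
  define q where "q = b + d 0"
  have "ostr_from (q * (q + 1) - 1) (\<lambda>k. d (Suc k)) \<in> cover i n (q * (q + 1) - 1)"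
    using Suc.prems by (intro Suc.IH) auto
  then have "1 / real q - ostr_from b d \<in> cover i n (q * (q + 1) - 1)"
    using ostr_from_step[of d b] Suc.prems by (simp add: q_def)
  moreover have "q = Suc (b + (d 0 - 1))" using Suc.prems(1)[of 0] by (simp add: q_def)
  ultimately show ?case by (simp del: of_nat_Suc) (metis)
qed

lemma emeasure_lborel_reflect:
  fixes c :: real
  assumes [measurable]: "A \<in> sets borel"
  shows "emeasure lborel ((\<lambda>x. c - x) -` A) = emeasure lborel A"
proof -
  have "distr lborel borel (\<lambda>x. c - x) = lborel"
    using lborel_real_affine[of "-1" c] by (simp add: density_1)
  then show ?thesis
    using emeasure_distr[of "\<lambda>x. c - x" lborel borel A] by simp
qed

text \<open>Induction on the position. Reflections preserve the measure, so with \<open>Q = q * (q + 1)\<close> the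
  induction step sums the bounds \<open>1 / (Q * (Q + 1))\<close> over \<open>q \<ge> b + 1\<close>. The factor \<open>1 / Q\<close>
  telescopes to \<open>1 / (b + 1)\<close>, and \<open>1 / (Q + 1)\<close> is at most its value at \<open>q = b + 1\<close>. The gain over
  the bound for \<open>b\<close> is smallest at \<open>b = 0\<close>, where it is exactly \<open>2/3\<close>; this is where the ratio comes
  from.\<close>
lemma emeasure_cover:
  assumes "i \<ge> 1"
  shows "emeasure lborel (cover i n b) \<le> ennreal ((2/3) ^ n / (real (b + 1) * real (b + 2)))"
proof (induction n arbitrary: b)
  case 0
  define q where "q = real (b + i)"
  have q: "q \<ge> real b + 1" using assms by (simp add: q_def)
  have "1 / q - 1 / (q + 1) = 1 / (q * (q + 1))" using q by (simp add: field_simps)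
  also have "\<dots> \<le> 1 / ((real b + 1) * (real b + 2))"
    using q by (intro divide_left_mono mult_mono) auto
  finally have "ennreal (1 / q - 1 / (q + 1)) \<le> ennreal (1 / ((real b + 1) * (real b + 2)))"
    by (rule ennreal_leI)
  moreover have "emeasure lborel {1 / (q + 1) .. 1 / q} = ennreal (1 / q - 1 / (q + 1))"
    using q by (simp add: divide_left_mono)
  ultimately show ?case by (simp add: q_def add_ac)
next
  case (Suc n)
  define q where "q j = real (Suc (b + j))" for j
  define C where "C = (2/3) ^ n / ((real b + 1) * (real b + 2) + 1)"
  let ?b = "\<lambda>j. Suc (b + j) * (Suc (b + j) + 1) - 1"
  have q: "q j \<ge> real b + 1" for j by (simp add: q_def)
  have C: "C \<ge> 0" by (simp add: C_def)
  have offset: "real (?b j + 1) = q j * (q j + 1)" for j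
    by (simp add: q_def algebra_simps)
  have "emeasure lborel (cover i (Suc n) b) \<le>
      (\<Sum>j. emeasure lborel ((\<lambda>x. 1 / real (Suc (b + j)) - x) -` cover i n (?b j)))"
    unfolding cover.simps
  proof (rule emeasure_subadditive_countably, safe)
    fix j
    have "(\<lambda>x. 1 / real (Suc (b + j)) - x) -` cover i n (?b j) \<inter> space borel \<in> sets borel"
      by (rule measurable_sets[OF _ cover_borel]) measurable
    then show "(\<lambda>x. 1 / real (Suc (b + j)) - x) -` cover i n (?b j) \<in> sets lborel" by simp
  qed
  also have "\<dots> = (\<Sum>j. emeasure lborel (cover i n (?b j)))"
    by (simp only: emeasure_lborel_reflect[OF cover_borel])
  also have "\<dots> \<le> (\<Sum>j. ennreal (C * (1 / q j - 1 / q (Suc j))))"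
  proof (rule suminf_le)
    fix j
    have "emeasure lborel (cover i n (?b j)) \<le>
        ennreal ((2/3) ^ n / (real (?b j + 1) * real (?b j + 2)))" by (rule Suc.IH)
    also have "(2/3) ^ n / (real (?b j + 1) * real (?b j + 2)) =
        (2/3) ^ n / (q j * (q j + 1) + 1) * (1 / (q j * (q j + 1)))"
    proof -
      have "real (?b j + 2) = q j * (q j + 1) + 1" using offset[of j] by linarith
      then show ?thesis unfolding offset by simp
    qed
    also have "\<dots> \<le> C * (1 / (q j * (q j + 1)))"
    proof (rule mult_right_mono)
      have "(real b + 1) * (real b + 2) + 1 \<le> q j * (q j + 1) + 1"
        using q[of j] by (intro add_right_mono mult_mono) auto
      then show "(2/3) ^ n / (q j * (q j + 1) + 1) \<le> C"
        unfolding C_def by (intro frac_le) (auto intro: add_nonneg_pos)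
      show "0 \<le> 1 / (q j * (q j + 1))" by (simp add: q_def)
    qed
    also have "1 / (q j * (q j + 1)) = 1 / q j - 1 / q (Suc j)"
      using q[of j] by (simp add: q_def field_simps)
    finally show "emeasure lborel (cover i n (?b j)) \<le> ennreal (C * (1 / q j - 1 / q (Suc j)))"
      by (simp add: ennreal_leI)
  qed auto
  also have "\<dots> = ennreal (C * (1 / q 0 - 0))"
  proof (rule suminf_ennreal_eq)
    have "(\<lambda>j. 1 / q j) \<longlonglongrightarrow> 0"
      using LIMSEQ_ignore_initial_segment[OF lim_1_over_n[where 'a=real], of "Suc b"]
      by (simp add: q_def add_ac)
    then show "(\<lambda>j. C * (1 / q j - 1 / q (Suc j))) sums (C * (1 / q 0 - 0))"
      by (intro sums_mult telescope_sums')
    show "0 \<le> C * (1 / q j - 1 / q (Suc j))" for j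
      using C by (intro mult_nonneg_nonneg) (auto simp: q_def divide_left_mono)
  qed
  also have "\<dots> \<le> ennreal ((2/3) ^ Suc n / (real (b + 1) * real (b + 2)))"
  proof (rule ennreal_leI)
    \<comment> \<open>The difference vanishes at \<open>b = 0\<close>, so the ratio \<open>2/3\<close> leaves no slack there.\<close>
    have "2/3 * (((real b + 1) * (real b + 2) + 1) * q 0) - real (b + 1) * real (b + 2) =
        (real b + 1) * real b * (2 * real b + 3) / 3"
      by (simp add: q_def field_simps)
    also have "\<dots> \<ge> 0" by simp
    finally have "real (b + 1) * real (b + 2) \<le> 2/3 * (((real b + 1) * (real b + 2) + 1) * q 0)"
      by simp
    then have "1 / (((real b + 1) * (real b + 2) + 1) * q 0) \<le>
        2/3 / (real (b + 1) * real (b + 2))"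
      using q[of 0] by (simp add: divide_le_eq le_divide_eq add_pos_pos)
    from mult_left_mono[OF this, of "(2/3) ^ n"]
    show "C * (1 / q 0 - 0) \<le> (2/3) ^ Suc n / (real (b + 1) * real (b + 2))"
      by (simp add: C_def)
  qed
  finally show ?case .
qed

lemma limsup_cover_null:
  assumes "i \<ge> 1"
  shows "limsup (\<lambda>n. cover i n b) \<in> null_sets lborel"
proof (rule borel_cantelli_limsup1)
  have bound: "emeasure lborel (cover i n b) \<le> ennreal ((2/3) ^ n)" for n
  proof -
    have "(2/3) ^ n / (real (b + 1) * real (b + 2)) \<le> (2/3 :: real) ^ n / (1 * 1)"
      by (intro divide_left_mono mult_mono) auto
    then have "ennreal ((2/3) ^ n / (real (b + 1) * real (b + 2))) \<le> ennreal ((2/3) ^ n)"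
      by (intro ennreal_leI) simp
    with emeasure_cover[OF assms, of n b] show ?thesis by (rule order_trans)
  qed
  then show "emeasure lborel (cover i n b) < \<infinity>" for n
    by (rule le_less_trans) simp
  have "measure lborel (cover i n b) \<le> (2/3) ^ n" for n
    unfolding measure_def using bound[of n] by (simp add: enn2real_leI)
  then show "summable (\<lambda>n. measure lborel (cover i n b))"
    by (intro summable_comparison_test'[OF summable_geometric[of "2/3::real"]]) auto
qed simp

section \<open>Independent increments\<close>

text \<open>By independence the probability of meeting the constraints \<open>D k\<close> at \<open>n\<close> successive times is at
  most \<open>c ^ n\<close>. With \<open>D k\<close> the complement of one value this says that the value recurs infinitely
  often; with \<open>D k\<close> a singleton it says that no fixed sequence is followed forever.\<close>
lemma (in prob_space) prob_tail_constraint_eq_0: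
  assumes "indep_vars N X (UNIV :: nat set)" "\<And>k. D k \<in> sets (N k)"
    and "\<And>k. prob (X k -` D k \<inter> space M) \<le> c" "c < 1"
  shows "AE \<omega> in M. \<exists>k\<ge>m. X k \<omega> \<notin> D k"
proof -
  have [measurable]: "X k -` D k \<inter> space M \<in> events" for k
    using assms(1) measurable_sets[OF _ assms(2)[of k], of "X k"] by (auto simp: indep_vars_def)
  let ?E = "\<Inter>k\<in>{m..}. X k -` D k \<inter> space M"
  have E: "?E \<in> events" by (intro sets.countable_INT') auto
  have "prob ?E \<le> c ^ Suc n" for n
  proof -
    have "prob ?E \<le> prob (\<Inter>k\<in>{m..m+n}. X k -` D k \<inter> space M)"
      by (intro finite_measure_mono sets.finite_INT INT_anti_mono) auto
    also have "\<dots> = (\<Prod>k\<in>{m..m+n}. prob (X k -` D k \<inter> space M))"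
      using assms(1,2) by (intro indep_varsD) auto
    also have "\<dots> \<le> (\<Prod>k\<in>{m..m+n}. c)"
      using assms(3) by (intro prod_mono) auto
    finally show ?thesis by simp
  qed
  moreover have "0 \<le> c" using assms(3)[of 0] measure_nonneg[of M] by (meson order_trans)
  then have "(\<lambda>n. c ^ Suc n) \<longlonglongrightarrow> 0" using \<open>c < 1\<close> by (intro LIMSEQ_Suc LIMSEQ_realpow_zero)
  ultimately have "prob ?E \<le> 0" by (intro LIMSEQ_le_const) auto
  then have "?E \<in> null_sets M"
    using E by (simp add: emeasure_eq_measure null_sets_def measure_le_0_iff)
  then show ?thesis
    by (rule AE_I') auto
qed

lemma (in prob_space) AE_pos_of_prob_sums:
  fixes X :: "'a \<Rightarrow> nat"
  assumes [measurable]: "X \<in> measurable M (count_space UNIV)"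
    and "(\<lambda>m. prob {\<omega> \<in> space M. X \<omega> = Suc m}) sums 1"
  shows "AE \<omega> in M. X \<omega> \<ge> 1"
proof -
  have "(\<lambda>m. prob {\<omega> \<in> space M. X \<omega> = Suc m}) sums
      prob (\<Union>m. {\<omega> \<in> space M. X \<omega> = Suc m})"
    by (intro finite_measure_UNION) (auto simp: disjoint_family_on_def)
  also have "(\<Union>m. {\<omega> \<in> space M. X \<omega> = Suc m}) = {\<omega> \<in> space M. X \<omega> \<ge> 1}"
    by (auto simp: Suc_le_eq gr0_conv_Suc)
  finally have "prob {\<omega> \<in> space M. X \<omega> \<ge> 1} = 1"
    using assms(2) sums_unique2 by blast
  then show ?thesis by (intro AE_I_eq_1) (auto simp: emeasure_eq_measure)
qed

theorem theorem3:
  fixes M :: "'a measure"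
    and p :: "nat \<Rightarrow> real"
    and \<eta> :: "nat \<Rightarrow> 'a \<Rightarrow> nat"
    and \<mu> :: "real measure"
  assumes "prob_space M"
    and "\<And>m. m \<ge> 1 \<Longrightarrow> p m \<ge> 0"
    and "(\<lambda>m. p (Suc m)) sums 1"
    and "prob_space.indep_vars M (\<lambda>_. count_space UNIV) \<eta> UNIV"
    and "\<And>k m. m \<ge> 1 \<Longrightarrow> measure M {\<omega> \<in> space M. \<eta> k \<omega> = m} = p m"
  defines "\<mu> \<equiv> distr M borel (\<lambda>\<omega>. ostr_bar2 (\<lambda>k. \<eta> k \<omega>))"
  shows "((purely_atomic \<mu> \<and> (\<exists>!x. is_atom \<mu> x)) \<longleftrightarrow> (\<exists>i\<ge>1. p i = 1)) \<and>
    (\<not> (\<exists>i\<ge>1. p i = 1) \<longrightarrow> singularly_continuous \<mu>)"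
proof -
  interpret prob_space M by fact
  note indep = assms(4)
  have [measurable]: "\<eta> k \<in> measurable M (count_space UNIV)" for k
    using indep by (auto simp: indep_vars_def)
  let ?f = "\<lambda>\<omega>. ostr_bar2 (\<lambda>k. \<eta> k \<omega>)"
  have f [measurable]: "?f \<in> borel_measurable M"
    by (rule borel_measurable_ostr_bar2) measurable
  interpret \<mu>: prob_space \<mu> unfolding \<mu>_def by (rule prob_space_distr) (rule f)
  have pos: "AE \<omega> in M. \<forall>k. \<eta> k \<omega> \<ge> 1"
    unfolding AE_all_countable using assms(3,5) by (intro allI AE_pos_of_prob_sums) simp_all
  have prob_mem: "prob (\<eta> k -` {m} \<inter> space M) = p m" if "m \<ge> 1" for k m
    using assms(5)[OF that, of k] by (simp add: vimage_def Int_def conj_commute)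
  have "\<exists>i\<ge>1. p i > 0"
  proof (rule ccontr)
    assume none: "\<not> (\<exists>i\<ge>1. p i > 0)"
    have "p (Suc m) = 0" for m
    proof -
      have "1 \<le> Suc m" by simp
      with none assms(2) have "\<not> 0 < p (Suc m)" "0 \<le> p (Suc m)" by blast+
      then show ?thesis by simp
    qed
    then show False using assms(3) by (simp add: sums_iff)
  qed
  then obtain i where i: "i \<ge> 1" "p i > 0" by blast

  have degenerate: "purely_atomic \<mu> \<and> (\<exists>!x. is_atom \<mu> x)" if j: "j \<ge> 1" "p j = 1" for j
  proof -
    have "AE \<omega> in M. \<forall>k. \<eta> k \<omega> = j"
      unfolding AE_all_countable using assms(5)[OF j(1)] j(2)
      by (intro allI AE_I_eq_1) (auto simp: emeasure_eq_measure)
    then have "AE \<omega> in M. ?f \<omega> = ostr_bar2 (\<lambda>_. j)" by eventually_elim simp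
    then have AE: "AE x in \<mu>. x = ostr_bar2 (\<lambda>_. j)"
      unfolding \<mu>_def by (subst AE_distr_iff) auto
    have sets: "{x} \<in> sets \<mu>" for x by (simp add: \<mu>_def)
    have one: "measure \<mu> {ostr_bar2 (\<lambda>_. j)} = 1"
      using AE sets by (subst \<mu>.prob_eq_1) auto
    have zero: "measure \<mu> {x} = 0" if "x \<noteq> ostr_bar2 (\<lambda>_. j)" for x
      using AE sets that by (subst \<mu>.prob_eq_0) auto
    have atom: "is_atom \<mu> x \<longleftrightarrow> x = ostr_bar2 (\<lambda>_. j)" for x
      using one zero[of x] by (cases "x = ostr_bar2 (\<lambda>_. j)") (auto simp: is_atom_def)
    then show ?thesis using AE by (simp add: purely_atomic_def)
  qed

  have singular: "\<exists>B \<in> sets borel. emeasure lborel B = 0 \<and> emeasure \<mu> (space \<mu> - B) = 0"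
  proof (intro bexI conjI)
    let ?B = "limsup (\<lambda>n. cover i n 0)"
    show "?B \<in> sets borel" by measurable
    show "emeasure lborel ?B = 0" using limsup_cover_null[OF i(1)] by blast
    have "prob (\<eta> k -` (- {i}) \<inter> space M) \<le> 1 - p i" for k
    proof -
      have "\<eta> k -` (- {i}) \<inter> space M = space M - (\<eta> k -` {i} \<inter> space M)" by auto
      then show ?thesis using prob_mem[OF i(1), of k] by (simp add: prob_compl)
    qed
    then have "AE \<omega> in M. \<exists>k\<ge>m. \<eta> k \<omega> \<notin> - {i}" for m
      using i by (intro prob_tail_constraint_eq_0[OF indep, where c = "1 - p i"]) auto
    then have "AE \<omega> in M. \<forall>m. \<exists>k\<ge>m. \<eta> k \<omega> = i" by (simp add: AE_all_countable)
    with pos have "AE \<omega> in M. ?f \<omega> \<in> ?B"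
    proof eventually_elim
      case (elim \<omega>)
      have "?f \<omega> \<in> cover i k 0" if "\<eta> k \<omega> = i" for k
        using ostr_from_in_cover[of "\<lambda>k. \<eta> k \<omega>" k i 0] elim that by simp
      with elim show ?case by (simp add: limsup_INF_SUP) (meson atLeast_iff)
    qed
    then have "AE x in \<mu>. x \<in> ?B" unfolding \<mu>_def by (subst AE_distr_iff) auto
    then show "emeasure \<mu> (space \<mu> - ?B) = 0"
      by (subst (asm) AE_iff_measurable[OF _ refl]) (auto simp: \<mu>_def Diff_eq Collect_neg_eq)
  qed

  have no_atom: "\<not> is_atom \<mu> x" if nd: "\<not> (\<exists>i\<ge>1. p i = 1)" for x
  proof -
    \<comment> \<open>Any value other than \<open>i\<close> has at most the probability that \<open>i\<close> leaves over.\<close>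
    define c where "c = max (p i) (1 - p i)"
    have le1: "p m \<le> 1" if "m \<ge> 1" for m
      using assms(5)[OF that, of 0] prob_le_1 by metis
    then have "c < 1" using i nd le1[of i] by (auto simp: c_def less_le)
    have le_c: "p m \<le> c" if "m \<ge> 1" for m
    proof (cases "m = i")
      case False
      have "p i + p m = prob ((\<eta> 0 -` {i} \<inter> space M) \<union> (\<eta> 0 -` {m} \<inter> space M))"
        unfolding prob_mem[OF i(1), of 0, symmetric] prob_mem[OF that, of 0, symmetric]
        using False by (intro finite_measure_Union[symmetric]) auto
      also have "\<dots> \<le> 1" by (rule prob_le_1)
      finally show ?thesis by (simp add: c_def)
    qed (simp add: c_def)
    have "AE \<omega> in M. ?f \<omega> \<noteq> x"
    proof (cases "\<exists>d. (\<forall>k. d k \<ge> 1) \<and> ostr_bar2 d = x")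
      case True
      then obtain d where d: "\<And>k. d k \<ge> 1" "ostr_bar2 d = x" by blast
      have "AE \<omega> in M. \<exists>k\<ge>0. \<eta> k \<omega> \<notin> {d k}"
        using le_c d(1) \<open>c < 1\<close> by (intro prob_tail_constraint_eq_0[OF indep]) (auto simp: prob_mem)
      with pos show ?thesis
      proof eventually_elim
        case (elim \<omega>)
        then show ?case
          using ostr_from_inj[of "\<lambda>k. \<eta> k \<omega>" d 0] d by auto
      qed
    next
      case False
      from pos show ?thesis
      proof eventually_elim
        case (elim \<omega>)
        have "\<not> ((\<forall>k. \<eta> k \<omega> \<ge> 1) \<and> ?f \<omega> = x)"
          using False by (rule contrapos_nn) (rule exI[of _ "\<lambda>k. \<eta> k \<omega>"])
        with elim show ?case by blast
      qed
    qed
    then have "AE y in \<mu>. y \<noteq> x" unfolding \<mu>_def by (subst AE_distr_iff) auto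
    then have "measure \<mu> {x} = 0"
      by (subst \<mu>.prob_eq_0) (auto simp: \<mu>_def)
    then show ?thesis by (simp add: is_atom_def)
  qed

  show ?thesis
    using degenerate no_atom singular unfolding singularly_continuous_def by blast
qed

end
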